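(* Let $d,m\in\mathbb{N}$, let $c:\mathbb{Z}^d\to\mathbb{Z}^d$ be a scalar homomorphism (i.e. $c(x_1,\dots,x_d)=(ax_1,\dots,ax_d)$ for some $a\in\mathbb{Z}\setminus\{0\}$) and let $\vec F=(F_1,\dots,F_m)$ be an $m$-tuple where, for each $i=1,\dots,m$, $F_i$ is a finite family of homomorphisms from $(\mathbb{Z}^d)^i$ to $\mathbb{Z}^d$. (1) For any finite partition $\mathbb{Z}^d=\bigcup_{i=1}^rC_i$, one of the $C_i$ contains $D(m,\vec F,c;\mathbf{s})$ for some $\mathbf{s}=(s_0,\dots,s_m)\in(\mathbb{Z}^d\setminus\{0\})^{m+1}$. (2) For any $r\in\mathbb{N}$, there exist $M\in\mathbb{N}$, a scalar homomorphism $C:\mathbb{Z}^d\to\mathbb{Z}^d$ and an $M$-tuple $\vec H=(H_1,\dots,H_M)$, where each $H_i$ is a finite family of homomorphisms from $(\mathbb{Z}^{d})^i$ to $\mathbb{Z}^d$, such that for any $\mathbf{S}\in(\mathbb{Z}^d\setminus\{0\})^{M+1}$ and any $r$-coloring of $D(M,\vec H,C;\mathbf{S})$, there exists $\mathbf{s}\in(\mathbb{Z}^d\setminus\{0\})^{m+1}$ such that $D(m,\vec F,c;\mathbf{s})$ is a subset of $D(M,\vec H,C;\mathbf{S})$ and is monochromatic.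
   Context: $\mathbb{N}=\{1,2,\dots\}$. For $m\in\mathbb{N}$, a homomorphism $c:\mathbb{Z}^d\to\mathbb{Z}^d$, a tuple $\vec F=(F_1,\dots,F_m)$ where $F_i$ is a finite set of functions $(\mathbb{Z}^d)^i\to\mathbb{Z}^d$, and $\mathbf{s}=(s_0,\dots,s_m)\in(\mathbb{Z}^d\setminus\{0\})^{m+1}$, define $$D(m,\vec F,c;\mathbf{s})=\{c(s_0)\}\cup\bigcup_{i=1}^m\{f(s_0,\dots,s_{i-1})+c(s_i): f\in F_i\}.$$ *)

theory Defs
  imports "HOL-Analysis.Finite_Cartesian_Product" "HOL-Library.Disjoint_Sets"
begin

text \<open>
  The group of integer vectors of dimension d is \<open>int ^ 'd\<close>, and its i-th power is
  represented by the lists of length \<open>i\<close>. An i-ary map is therefore a function on lists of which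
  only the values on lists of length \<open>i\<close> matter.
\<close>

definition tuple_hom :: "nat \<Rightarrow> ((int ^ 'd) list \<Rightarrow> int ^ 'd) \<Rightarrow> bool" where
  "tuple_hom i f \<longleftrightarrow>
     (\<forall>xs ys. length xs = i \<and> length ys = i \<longrightarrow> f (map2 (+) xs ys) = f xs + f ys)"

definition scalar_hom :: "(int ^ 'd \<Rightarrow> int ^ 'd) \<Rightarrow> bool" where
  "scalar_hom c \<longleftrightarrow> (\<exists>a. a \<noteq> 0 \<and> (\<forall>x. c x = a *s x))"

text \<open>
  An m-tuple of families is a function on \<open>nat\<close> of which only the values at \<open>1, \<dots>, m\<close> matter.
\<close>

definition hom_families ::
    "nat \<Rightarrow> (nat \<Rightarrow> ((int ^ 'd) list \<Rightarrow> int ^ 'd) set) \<Rightarrow> bool" where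
  "hom_families m F \<longleftrightarrow> (\<forall>i\<in>{1..m}. finite (F i) \<and> (\<forall>f\<in>F i. tuple_hom i f))"

definition nonzero_tuples :: "nat \<Rightarrow> (int ^ 'd) list set" where
  "nonzero_tuples n = {s. length s = n \<and> (\<forall>x\<in>set s. x \<noteq> 0)}"

text \<open>
  In \<open>D_set m F c s\<close> the list \<open>s\<close> has length \<open>m + 1\<close>; \<open>take i s\<close> consists of the entries
  with indices \<open>0, \<dots>, i - 1\<close>.
\<close>

definition D_set ::
    "nat \<Rightarrow> (nat \<Rightarrow> ((int ^ 'd) list \<Rightarrow> int ^ 'd) set) \<Rightarrow> (int ^ 'd \<Rightarrow> int ^ 'd) \<Rightarrow>
     (int ^ 'd) list \<Rightarrow> (int ^ 'd) set" where
  "D_set m F c s = {c (s ! 0)} \<union> (\<Union>i\<in>{1..m}. {f (take i s) + c (s ! i) | f. f \<in> F i})"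

end

theory Submission
  imports Defs
begin

text \<open>
  Write a D-set as a sequence of rows, the row of index \<open>i\<close> consisting of the vectors
  \<open>a x\<^sub>i + \<phi>(x\<^sub>0, \<dots>, x\<^sub>i\<^sub>-\<^sub>1)\<close>. It suffices to find a subsystem of a larger D-set in which
  every row is monochromatic: among \<open>r m + 1\<close> such rows, \<open>m + 1\<close> have the same colour, and
  they form the required D-set if all substitutions of increasing subsequences were put into the
  families in advance.

  Such a subsystem is built by induction on the number of rows. If \<open>M\<close> entries suffice for the
  first \<open>n\<close> rows, replace each of them by a block of \<open>N\<close> entries and add one last entry \<open>x\<close>,
  whose row consists of \<open>A x + a \<Sum>\<^sub>k e\<^sub>k(y\<^sub>k)\<close> with \<open>y\<^sub>k\<close> the vector of the \<open>k\<close>-th entries of the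
  blocks and \<open>e\<close> any word of length \<open>N\<close> over a finite alphabet of homomorphisms. By the
  Hales--Jewett theorem some combinatorial line of words gives a single colour. Summing the
  \<open>y\<^sub>k\<close> over its active coordinates yields the new entries for the first \<open>n\<close> rows, and its
  fixed coordinates determine the new entry for the last one.
\<close>

subsection \<open>The Hales--Jewett theorem\<close>

definition words :: "nat \<Rightarrow> 'a set \<Rightarrow> 'a list set" where
  "words N E = {w. set w \<subseteq> E \<and> length w = N}"

text \<open>\<open>None\<close> is the variable of a line: it marks the active coordinates,
  \<open>Some e\<close> the fixed ones.\<close>

definition subst_line :: "'a option list \<Rightarrow> 'a \<Rightarrow> 'a list" where
  "subst_line l e = map (case_option e id) l"

definition comb_lines :: "nat \<Rightarrow> 'a set \<Rightarrow> 'a option list set" where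
  "comb_lines N E = {l. length l = N \<and> set l \<subseteq> insert None (Some ` E) \<and> None \<in> set l}"

definition mono_line :: "nat \<Rightarrow> 'a set \<Rightarrow> ('a list \<Rightarrow> 'c) \<Rightarrow> bool" where
  "mono_line N E col \<longleftrightarrow> (\<exists>l\<in>comb_lines N E. \<exists>k. \<forall>e\<in>E. col (subst_line l e) = k)"

definition hales_jewett :: "'a set \<Rightarrow> bool" where
  "hales_jewett E \<longleftrightarrow>
     (\<forall>r. \<exists>N. \<forall>col :: 'a list \<Rightarrow> nat. (\<forall>w\<in>words N E. col w < r) \<longrightarrow> mono_line N E col)"

lemma finite_words: "finite E \<Longrightarrow> finite (words N E)"
  unfolding words_def by (rule finite_lists_length_eq)

lemma words_mono: "E \<subseteq> E' \<Longrightarrow> words N E \<subseteq> words N E'"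
  by (auto simp: words_def)

lemma append_in_words: "v \<in> words N E \<Longrightarrow> w \<in> words N' E \<Longrightarrow> v @ w \<in> words (N + N') E"
  by (auto simp: words_def)

lemma subst_line_in_words:
  assumes "l \<in> comb_lines N E" "e \<in> E"
  shows "subst_line l e \<in> words N E"
proof -
  have "case_option e id y \<in> E" if "y \<in> set l" for y
    using that assms by (cases y) (auto simp: comb_lines_def)
  then show ?thesis using assms by (auto simp: words_def comb_lines_def subst_line_def)
qed

lemma subst_line_append [simp]: "subst_line (l @ l') e = subst_line l e @ subst_line l' e"
  by (simp add: subst_line_def)

lemma subst_line_const [simp]: "subst_line (map Some w) e = w"
  by (simp add: subst_line_def o_def)

lemma comb_lines_mono: "E \<subseteq> E' \<Longrightarrow> comb_lines N E \<subseteq> comb_lines N E'"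
  by (auto simp: comb_lines_def)

lemma comb_lines_append:
  "l \<in> comb_lines N E \<Longrightarrow> l' \<in> comb_lines N' E \<Longrightarrow> l @ l' \<in> comb_lines (N + N') E"
  "l \<in> comb_lines N E \<Longrightarrow> w \<in> words N' E \<Longrightarrow> l @ map Some w \<in> comb_lines (N + N') E"
  "w \<in> words N E \<Longrightarrow> l' \<in> comb_lines N' E \<Longrightarrow> map Some w @ l' \<in> comb_lines (N + N') E"
  by (auto simp: comb_lines_def words_def)

text \<open>Renumbering the colours frees them from the type \<open>nat\<close>. The focusing
  argument needs this because its colours are themselves colourings.\<close>

lemma hales_jewett_finite_colours:
  assumes "hales_jewett E" and "finite K"
  obtains N where "\<And>col :: 'a list \<Rightarrow> 'c. (\<forall>w\<in>words N E. col w \<in> K) \<Longrightarrow> mono_line N E col"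
proof -
  obtain h where h: "bij_betw h K {0..<card K}"
    using ex_bij_betw_finite_nat[OF assms(2)] by blast
  obtain N where N: "\<And>col :: 'a list \<Rightarrow> nat. (\<forall>w\<in>words N E. col w < card K) \<Longrightarrow> mono_line N E col"
    using assms(1) unfolding hales_jewett_def by blast
  have "mono_line N E col" if col: "\<forall>w\<in>words N E. col w \<in> K" for col :: "'a list \<Rightarrow> 'c"
  proof -
    have "\<forall>w\<in>words N E. (h \<circ> col) w < card K"
      using col h by (force simp: bij_betw_def)
    then obtain l k where l: "l \<in> comb_lines N E" and k: "\<forall>e\<in>E. h (col (subst_line l e)) = k"
      using N[of "h \<circ> col"] unfolding mono_line_def by auto
    have "col (subst_line l e) = the_inv_into K h k" if "e \<in> E" for e
      using k that col subst_line_in_words[OF l that] h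
      by (metis bij_betw_def the_inv_into_f_f)
    then show ?thesis unfolding mono_line_def using l by blast
  qed
  then show ?thesis using that by blast
qed

text \<open>
  Colour focusing: the lines \<open>l\<close> all end in the same word \<open>p\<close> at the new letter \<open>x\<close>, and their
  restrictions to \<open>E\<close> are monochromatic with the pairwise different colours in \<open>K\<close>.
\<close>

definition focused :: "nat \<Rightarrow> 'a set \<Rightarrow> 'a \<Rightarrow> ('a list \<Rightarrow> nat) \<Rightarrow> nat set \<Rightarrow> 'a list \<Rightarrow> bool" where
  "focused N E x col K p \<longleftrightarrow> p \<in> words N (insert x E) \<and>
     (\<forall>k\<in>K. \<exists>l\<in>comb_lines N (insert x E).
        subst_line l x = p \<and> (\<forall>e\<in>E. col (subst_line l e) = k))"

text \<open>The line of colour \<open>col p\<close> has \<open>p\<close> as its point at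
  \<open>x\<close>, so it keeps its colour over the enlarged alphabet.\<close>

lemma focused_imp_mono_line:
  assumes "focused N E x col K p" and "col p \<in> K"
  shows "mono_line N (insert x E) col"
  using assms unfolding focused_def mono_line_def by (metis insert_iff)

text \<open>Unless a monochromatic line exists, longer words allow one more focused colour. With
  \<open>r\<close> focused colours none is left for the focus.\<close>

lemma hales_jewett_insert:
  assumes fin: "finite E" and ne: "E \<noteq> {}" and HJ: "hales_jewett E"
  shows "hales_jewett (insert x E)"
  unfolding hales_jewett_def
proof
  fix r :: nat
  let ?E = "insert x E"
  have focusing: "\<exists>N. \<forall>col. (\<forall>w\<in>words N ?E. col w < r) \<longrightarrow>
      mono_line N ?E col \<or> (\<exists>K p. K \<subseteq> {..<r} \<and> card K = s \<and> focused N E x col K p)" for s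
  proof (induction s)
    case 0
    have "focused 0 E x col {} []" for col
      by (simp add: focused_def words_def)
    then show ?case by (metis card.empty empty_subsetI)
  next
    case (Suc s)
    then obtain N where N: "\<And>col. (\<forall>w\<in>words N ?E. col w < r) \<Longrightarrow>
      mono_line N ?E col \<or> (\<exists>K p. K \<subseteq> {..<r} \<and> card K = s \<and> focused N E x col K p)"
      by blast
    \<comment> \<open>A suffix of length \<open>N'\<close> is coloured by the entire colouring it
      induces on prefixes. Restriction to \<open>words N ?E\<close> makes these colours finite in
      number.\<close>
    define colours where "colours = words N ?E \<rightarrow>\<^sub>E {..<r}"
    have "finite colours"
      unfolding colours_def using fin by (intro finite_PiE finite_words) auto
    then obtain N' where N': "\<And>col :: 'a list \<Rightarrow> 'a list \<Rightarrow> nat.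
        (\<forall>w\<in>words N' E. col w \<in> colours) \<Longrightarrow> mono_line N' E col"
      using hales_jewett_finite_colours[OF HJ] by blast
    show ?case
    proof (intro exI allI impI)
      fix col :: "'a list \<Rightarrow> nat"
      assume col: "\<forall>w\<in>words (N + N') ?E. col w < r"
      have "mono_line N' E (\<lambda>w'. restrict (\<lambda>w. col (w @ w')) (words N ?E))"
        using col words_mono[of E ?E] append_in_words
        by (intro N') (fastforce simp: colours_def)
      then obtain l' g0 where l': "l' \<in> comb_lines N' E"
        and g0: "\<forall>e\<in>E. restrict (\<lambda>w. col (w @ subst_line l' e)) (words N ?E) = g0"
        unfolding mono_line_def by blast
      have l'_in: "l' \<in> comb_lines N' ?E"
        using l' comb_lines_mono[of E ?E] by blast
      obtain e0 where e0: "e0 \<in> E" using ne by blast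
      \<comment> \<open>Along \<open>l'\<close> all letters of \<open>E\<close> induce the same
        colouring \<open>g\<close> of the prefixes, and \<open>e0\<close> merely represents them.
        The letter \<open>x\<close> may induce another one.\<close>
      define g where "g w = col (w @ subst_line l' e0)" for w
      have g: "col (w @ subst_line l' e) = g w" if "e \<in> E" "w \<in> words N ?E" for e w
        using g0 that e0 unfolding g_def by (metis restrict_apply')
      have e0_word: "subst_line l' e0 \<in> words N' ?E"
        using subst_line_in_words[OF l'_in] e0 by blast
      have g_less: "\<forall>w\<in>words N ?E. g w < r"
        using col e0_word append_in_words unfolding g_def by blast
      show "mono_line (N + N') ?E col \<or>
          (\<exists>K p. K \<subseteq> {..<r} \<and> card K = Suc s \<and> focused (N + N') E x col K p)"
      proof (cases "mono_line N ?E g")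
        case True
        then obtain l k where l: "l \<in> comb_lines N ?E" and k: "\<forall>e\<in>?E. g (subst_line l e) = k"
          unfolding mono_line_def by blast
        \<comment> \<open>A full line for \<open>g\<close> becomes one for \<open>col\<close> by
          freezing the suffix at \<open>e0\<close>.\<close>
        have "l @ map Some (subst_line l' e0) \<in> comb_lines (N + N') ?E"
          using comb_lines_append(2)[OF l e0_word] .
        moreover have "\<forall>e\<in>?E. col (subst_line (l @ map Some (subst_line l' e0)) e) = k"
          using k unfolding g_def by simp
        ultimately show ?thesis unfolding mono_line_def by blast
      next
        case False
        then obtain K p where K: "K \<subseteq> {..<r}" "card K = s" and foc: "focused N E x g K p"
          using N[OF g_less] by blast
        have p: "p \<in> words N ?E" using foc unfolding focused_def by blast
        have new: "g p \<notin> K" using focused_imp_mono_line[OF foc] False by blast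
        \<comment> \<open>Old colours survive on lines \<open>l @ l'\<close> moving in both parts;
          the new colour \<open>g p\<close> comes from the fixed prefix \<open>p\<close> followed by
          \<open>l'\<close>.\<close>
        have "\<exists>l\<in>comb_lines (N + N') ?E. subst_line l x = p @ subst_line l' x \<and>
            (\<forall>e\<in>E. col (subst_line l e) = k)" if k: "k \<in> insert (g p) K" for k
        proof (cases "k \<in> K")
          case True
          then obtain l where l: "l \<in> comb_lines N ?E" "subst_line l x = p"
            "\<forall>e\<in>E. g (subst_line l e) = k"
            using foc unfolding focused_def by blast
          have "\<forall>e\<in>E. col (subst_line (l @ l') e) = k"
            using g l(3) subst_line_in_words[OF l(1)] by simp
          then show ?thesis
            using comb_lines_append(1)[OF l(1) l'_in] l(2) by (metis subst_line_append)
        next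
          case False
          then have "\<forall>e\<in>E. col (subst_line (map Some p @ l') e) = k"
            using k g p by simp
          then show ?thesis
            using comb_lines_append(3)[OF p l'_in] by (metis subst_line_append subst_line_const)
        qed
        moreover have "p @ subst_line l' x \<in> words (N + N') ?E"
          using p subst_line_in_words[OF l'_in] append_in_words by blast
        ultimately have "focused (N + N') E x col (insert (g p) K) (p @ subst_line l' x)"
          unfolding focused_def by blast
        moreover have "card (insert (g p) K) = Suc s"
          using new K finite_subset[OF K(1)] by simp
        moreover have "insert (g p) K \<subseteq> {..<r}"
          using K g_less p by blast
        ultimately show ?thesis by blast
      qed
    qed
  qed
  obtain N where N: "\<And>col. (\<forall>w\<in>words N ?E. col w < r) \<Longrightarrow>
      mono_line N ?E col \<or> (\<exists>K p. K \<subseteq> {..<r} \<and> card K = r \<and> focused N E x col K p)"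
    using focusing by blast
  have "mono_line N ?E col" if col: "\<forall>w\<in>words N ?E. col w < r" for col
  proof (rule ccontr)
    assume no: "\<not> mono_line N ?E col"
    then obtain K p where K: "K \<subseteq> {..<r}" "card K = r" and foc: "focused N E x col K p"
      using N[OF col] by blast
    have "K = {..<r}" using K by (intro card_subset_eq) auto
    then show False
      using focused_imp_mono_line[OF foc] col foc no unfolding focused_def by blast
  qed
  then show "\<exists>N. \<forall>col. (\<forall>w\<in>words N ?E. col w < r) \<longrightarrow> mono_line N ?E col" by blast
qed

theorem hales_jewett:
  assumes "finite E" and "E \<noteq> {}"
  shows "hales_jewett E"
  using assms
proof (induction E rule: finite_ne_induct)
  case (singleton x)
  have "[None] \<in> comb_lines 1 {x}" by (simp add: comb_lines_def)
  then have "mono_line 1 {x} col" for col :: "'a list \<Rightarrow> nat" unfolding mono_line_def by blast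
  then show ?case unfolding hales_jewett_def by blast
next
  case (insert x E)
  then show ?case by (simp add: hales_jewett_insert)
qed

subsection \<open>Monochromatic rows\<close>

text \<open>Homomorphisms from the \<open>i\<close>-th power are encoded on infinite sequences, of
  which they read only the first \<open>i\<close> entries. A map then stays the same when its arity
  grows, and substitutions compose directly.\<close>

definition init_hom :: "nat \<Rightarrow> ((nat \<Rightarrow> int ^ 'd) \<Rightarrow> int ^ 'd) \<Rightarrow> bool" where
  "init_hom i \<phi> \<longleftrightarrow> (\<forall>x y. \<phi> (\<lambda>k. x k + y k) = \<phi> x + \<phi> y) \<and>
     (\<forall>x y. (\<forall>k<i. x k = y k) \<longrightarrow> \<phi> x = \<phi> y)"

lemma init_homD:
  assumes "init_hom i \<phi>"
  shows "\<phi> (\<lambda>k. x k + y k) = \<phi> x + \<phi> y"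
    and "(\<And>k. k < i \<Longrightarrow> x k = y k) \<Longrightarrow> \<phi> x = \<phi> y"
  using assms unfolding init_hom_def by blast+

lemma init_hom_coord: "k < i \<Longrightarrow> init_hom i (\<lambda>x. x k)"
  by (simp add: init_hom_def)

lemma init_hom_0: "init_hom i (\<lambda>x. 0)"
  by (simp add: init_hom_def)

lemma init_hom_add: "init_hom i \<phi> \<Longrightarrow> init_hom i \<psi> \<Longrightarrow> init_hom i (\<lambda>x. \<phi> x + \<psi> x)"
  unfolding init_hom_def by (simp add: algebra_simps) metis

lemma init_hom_smult: "init_hom i \<phi> \<Longrightarrow> init_hom i (\<lambda>x. a *s \<phi> x)"
  unfolding init_hom_def by (simp add: vector_add_ldistrib) metis

lemma init_hom_sum: "(\<And>k. k \<in> I \<Longrightarrow> init_hom i (\<phi> k)) \<Longrightarrow> init_hom i (\<lambda>x. \<Sum>k\<in>I. \<phi> k x)"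
  by (induction I rule: infinite_finite_induct) (auto intro: init_hom_0 init_hom_add)

lemma init_hom_compose:
  assumes "init_hom i \<phi>" and "\<And>k. k < i \<Longrightarrow> init_hom j (\<lambda>x. \<sigma> x k)"
  shows "init_hom j (\<lambda>x. \<phi> (\<sigma> x))"
  unfolding init_hom_def
proof (intro conjI allI impI)
  fix x y
  have "\<phi> (\<sigma> (\<lambda>k. x k + y k)) = \<phi> (\<lambda>k. \<sigma> x k + \<sigma> y k)"
    by (rule init_homD(2)[OF assms(1)]) (rule init_homD(1)[OF assms(2)])
  then show "\<phi> (\<sigma> (\<lambda>k. x k + y k)) = \<phi> (\<sigma> x) + \<phi> (\<sigma> y)"
    using init_homD(1)[OF assms(1)] by simp
next
  fix x y :: "nat \<Rightarrow> int ^ 'a"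
  assume "\<forall>k<j. x k = y k"
  then show "\<phi> (\<sigma> x) = \<phi> (\<sigma> y)"
    using init_homD(2)[OF assms(1)] init_homD(2)[OF assms(2)] by metis
qed

lemma init_hom_zero:
  assumes "init_hom i \<phi>"
  shows "\<phi> (\<lambda>k. 0) = 0"
  using init_homD(1)[OF assms, of "\<lambda>k. 0" "\<lambda>k. 0"] by simp

lemma init_hom_apply_sum:
  assumes "init_hom i \<phi>"
  shows "\<phi> (\<lambda>k. \<Sum>q\<in>I. y q k) = (\<Sum>q\<in>I. \<phi> (y q))"
  by (induction I rule: infinite_finite_induct)
    (simp_all add: init_hom_zero[OF assms] init_homD(1)[OF assms])

lemma init_hom_apply_smult:
  assumes "init_hom i \<phi>"
  shows "\<phi> (\<lambda>k. a *s x k) = a *s \<phi> x"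
proof (induction a rule: int_induct[where k = 0])
  case base
  then show ?case using init_hom_zero[OF assms] by simp
next
  case (step1 a)
  then show ?case using init_homD(1)[OF assms, of "\<lambda>k. a *s x k" x]
    by (simp add: vector_sadd_rdistrib)
next
  case (step2 a)
  then show ?case using init_homD(1)[OF assms, of "\<lambda>k. (a - 1) *s x k" x]
    by (simp add: vector_sub_rdistrib)
qed

text \<open>Unlike in a D-set, row 0 has a family too. A map with \<open>init_hom 0\<close> is
  constant and additive, hence zero, so this adds nothing beyond \<open>a *s s 0\<close>.\<close>

definition hom_row ::
    "int \<Rightarrow> ((nat \<Rightarrow> int ^ 'd) \<Rightarrow> int ^ 'd) set \<Rightarrow> nat \<Rightarrow> (nat \<Rightarrow> int ^ 'd) \<Rightarrow> (int ^ 'd) set" where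
  "hom_row a \<Phi> i s = (\<lambda>\<phi>. a *s s i + \<phi> s) ` \<Phi>"

definition hom_rows ::
    "nat \<Rightarrow> (nat \<Rightarrow> ((nat \<Rightarrow> int ^ 'd) \<Rightarrow> int ^ 'd) set) \<Rightarrow> int \<Rightarrow> (nat \<Rightarrow> int ^ 'd) \<Rightarrow> (int ^ 'd) set"
  where "hom_rows n G a s = (\<Union>i<n. hom_row a (G i) i s)"

definition admissible :: "nat \<Rightarrow> (nat \<Rightarrow> ((nat \<Rightarrow> int ^ 'd) \<Rightarrow> int ^ 'd) set) \<Rightarrow> bool" where
  "admissible n G \<longleftrightarrow> (\<forall>i<n. finite (G i) \<and> (\<forall>\<phi>\<in>G i. init_hom i \<phi>))"

text \<open>The entries are cut into consecutive blocks of length \<open>N\<close>; this is the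
  vector \<open>y_k\<close> of the overview.\<close>

definition block :: "nat \<Rightarrow> nat \<Rightarrow> (nat \<Rightarrow> int ^ 'd) \<Rightarrow> nat \<Rightarrow> int ^ 'd" where
  "block N k x j = x (j * N + k)"

lemma block_index_less: "i < j \<Longrightarrow> k < N \<Longrightarrow> i * N + k < j * (N::nat)"
  using mult_le_mono1[of "Suc i" j N] by simp

lemma init_hom_block: "k < N \<Longrightarrow> i < j \<Longrightarrow> j * N \<le> q \<Longrightarrow> init_hom q (\<lambda>x. block N k x i)"
  unfolding block_def by (intro init_hom_coord) (use block_index_less[of i j k N] in linarith)

text \<open>The factor \<open>a\<close> matches the coefficient of the word sums in the last row:
  \<open>a\<close> times \<open>e y\<close> is \<open>e\<close> at \<open>a\<close> times
  \<open>y\<close>, so no division occurs.\<close>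

definition block_sum :: "int \<Rightarrow> nat \<Rightarrow> nat set \<Rightarrow> (nat \<Rightarrow> int ^ 'd) \<Rightarrow> nat \<Rightarrow> int ^ 'd" where
  "block_sum a N I x j = a *s (\<Sum>k\<in>I. block N k x j)"

lemma init_hom_block_sum:
  "I \<subseteq> {..<N} \<Longrightarrow> i < j \<Longrightarrow> j * N \<le> q \<Longrightarrow> init_hom q (\<lambda>x. block_sum a N I x i)"
  unfolding block_sum_def by (intro init_hom_smult init_hom_sum init_hom_block) auto

definition word_sum :: "nat \<Rightarrow> ((nat \<Rightarrow> int ^ 'd) \<Rightarrow> int ^ 'd) list \<Rightarrow> (nat \<Rightarrow> int ^ 'd) \<Rightarrow> int ^ 'd"
  where "word_sum N w x = (\<Sum>k<N. (w ! k) (block N k x))"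

lemma init_hom_word_sum:
  assumes "w \<in> words N E" and "\<And>e. e \<in> E \<Longrightarrow> init_hom m e"
  shows "init_hom (m * N) (word_sum N w)"
proof -
  have "init_hom (m * N) (\<lambda>x. (w ! k) (block N k x))" if "k < N" for k
  proof -
    have "w ! k \<in> E" using that assms(1) by (auto simp: words_def)
    from init_hom_compose[OF assms(2)[OF this]] show ?thesis
      using that init_hom_block[of k N _ m "m * N"] by blast
  qed
  then have "init_hom (m * N) (\<lambda>x. \<Sum>k<N. (w ! k) (block N k x))"
    by (intro init_hom_sum) auto
  then show ?thesis by (simp add: word_sum_def[abs_def])
qed

text \<open>Only the active coordinates depend on the letter, and linearity merges them into one
  value of \<open>e\<close>. Substituting the zero map isolates the fixed coordinates.\<close>

lemma word_sum_subst_line: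
  assumes l: "length l = N" and e: "init_hom m e"
  defines "I \<equiv> {k. k < N \<and> l ! k = None}"
  shows "a *s word_sum N (subst_line l e) x =
    a *s word_sum N (subst_line l (\<lambda>x. 0)) x + e (block_sum a N I x)"
proof -
  have "(subst_line l e ! k) (block N k x) = (subst_line l (\<lambda>x. 0) ! k) (block N k x) +
      (if k \<in> I then e (block N k x) else 0)" if "k < N" for k
    using that l by (cases "l ! k") (auto simp: subst_line_def I_def)
  then have "word_sum N (subst_line l e) x =
      (\<Sum>k<N. (subst_line l (\<lambda>x. 0) ! k) (block N k x) + (if k \<in> I then e (block N k x) else 0))"
    unfolding word_sum_def by (intro sum.cong) auto
  also have "\<dots> = word_sum N (subst_line l (\<lambda>x. 0)) x + (\<Sum>k\<in>{..<N} \<inter> I. e (block N k x))"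
    by (simp add: sum.distrib word_sum_def sum.inter_restrict)
  also have "{..<N} \<inter> I = I" by (auto simp: I_def)
  also have "(\<Sum>k\<in>I. e (block N k x)) = e (\<lambda>j. \<Sum>k\<in>I. block N k x j)"
    using init_hom_apply_sum[OF e, of "\<lambda>k. block N k x" I] by simp
  finally show ?thesis
    using init_hom_apply_smult[OF e, of a "\<lambda>j. \<Sum>k\<in>I. block N k x j"]
    by (simp add: vector_add_ldistrib block_sum_def[abs_def])
qed

text \<open>The substitutions form a finite set fixed before the colouring, because the alphabet of
  the next induction step must contain every map they can produce.\<close>

lemma monochromatic_rows:
  fixes G :: "nat \<Rightarrow> ((nat \<Rightarrow> int ^ 'd) \<Rightarrow> int ^ 'd) set"
  assumes "admissible n G" and a: "a \<noteq> 0"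
  shows "\<exists>M H A \<Sigma>. A \<noteq> 0 \<and> admissible M H \<and> finite \<Sigma> \<and>
    (\<forall>\<sigma>\<in>\<Sigma>. \<forall>i<n. init_hom M (\<lambda>x. \<sigma> x i)) \<and>
    (\<forall>x (col :: int ^ 'd \<Rightarrow> nat). (\<forall>v. col v < r) \<longrightarrow>
       (\<exists>\<sigma>\<in>\<Sigma>. \<forall>i<n. hom_row a (G i) i (\<sigma> x) \<subseteq> hom_rows M H A x \<and>
          (\<exists>k. \<forall>v\<in>hom_row a (G i) i (\<sigma> x). col v = k)))"
  using assms(1)
proof (induction n)
  case 0
  show ?case
    by (intro exI[of _ 0] exI[of _ G] exI[of _ 1] exI[of _ "{id}"]) (simp add: admissible_def)
next
  case (Suc n)
  then have "admissible n G" by (simp add: admissible_def)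
  then obtain M' H' A' \<Sigma>' where A': "A' \<noteq> 0" and H': "admissible M' H'" and fin': "finite \<Sigma>'"
    and \<Sigma>': "\<And>\<sigma> i. \<sigma> \<in> \<Sigma>' \<Longrightarrow> i < n \<Longrightarrow> init_hom M' (\<lambda>x. \<sigma> x i)"
    and IH: "\<And>x (col :: int ^ 'd \<Rightarrow> nat). (\<forall>v. col v < r) \<Longrightarrow>
       \<exists>\<sigma>\<in>\<Sigma>'. \<forall>i<n. hom_row a (G i) i (\<sigma> x) \<subseteq> hom_rows M' H' A' x \<and>
          (\<exists>k. \<forall>v\<in>hom_row a (G i) i (\<sigma> x). col v = k)"
    using Suc.IH by blast
  \<comment> \<open>These are the maps that \<open>G n\<close> can contribute after some
    substitution for the first \<open>n\<close> entries. The zero map serves to evaluate the fixed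
    coordinates of a line.\<close>
  define E where "E = insert (\<lambda>x. 0) ((\<lambda>(\<phi>, \<sigma>) x. \<phi> (\<sigma> x)) ` (G n \<times> \<Sigma>'))"
  have G: "finite (G i)" "\<phi> \<in> G i \<Longrightarrow> init_hom i \<phi>" if "i < Suc n" for i \<phi>
    using Suc.prems that by (auto simp: admissible_def)
  have finE: "finite E" using G(1)[of n] fin' by (simp add: E_def)
  have E: "init_hom M' e" if "e \<in> E" for e
  proof -
    have "init_hom M' (\<lambda>x. \<phi> (\<sigma> x))" if "\<phi> \<in> G n" "\<sigma> \<in> \<Sigma>'" for \<phi> \<sigma>
      by (rule init_hom_compose[OF G(2)[of n]]) (use that \<Sigma>' in auto)
    then show ?thesis using that init_hom_0 by (auto simp: E_def)
  qed
  have zeroE: "(\<lambda>x. 0) \<in> E" by (simp add: E_def)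
  have "hales_jewett E" using hales_jewett[OF finE] zeroE by blast
  then obtain N where N: "\<And>col :: _ \<Rightarrow> nat. (\<forall>w\<in>words N E. col w < r) \<Longrightarrow> mono_line N E col"
    unfolding hales_jewett_def by blast
  define M where "M = M' * N"
  \<comment> \<open>One coefficient suits all rows: \<open>A'\<close> times a block sum carries
    \<open>a * A'\<close>, and so does \<open>a\<close> times the new entry built from
    \<open>A' *s x M\<close>.\<close>
  define A where "A = a * A'"
  \<comment> \<open>When row \<open>j\<close> of the inductive system is evaluated at block sums,
    \<open>x (j * N + p)\<close> with \<open>p\<close> the maximum of \<open>I\<close> becomes its
    leading entry. This map is the rest, which involves only earlier entries.\<close>
  define top_map where "top_map I p j h =
    (\<lambda>x. A *s (\<Sum>k\<in>I - {p}. block N k x j) + h (block_sum a N I x))"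
    for I p j and h :: "(nat \<Rightarrow> int ^ 'd) \<Rightarrow> int ^ 'd"
  \<comment> \<open>The line is not yet known, so every set \<open>I\<close> of active coordinates
    is provided for.\<close>
  define low where "low q = (\<Union>I\<in>Pow {..<N}. \<Union>p\<in>{..<N}. \<Union>j\<in>{..<M'}.
      if p \<in> I \<and> (\<forall>k\<in>I. k \<le> p) \<and> q = j * N + p
      then top_map I p j ` H' j else {})" for q
  define H where "H q = (if q = M then (\<lambda>w x. a *s word_sum N w x) ` words N E else low q)" for q
  \<comment> \<open>A substitution records an inductive one, the active set of a line, and a word
    carrying its fixed coordinates.\<close>
  define \<Sigma> where "\<Sigma> = (\<lambda>(\<sigma>, I, w) x i.
      if i < n then \<sigma> (block_sum a N I x) i else A' *s x M + word_sum N w x) `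
      (\<Sigma>' \<times> Pow {..<N} \<times> words N E)"
  have low_hom: "init_hom q \<phi>" if mem: "\<phi> \<in> low q" for \<phi> q
  proof -
    obtain I p j h where I: "I \<subseteq> {..<N}" and p: "p < N" "\<forall>k\<in>I. k \<le> p" and j: "j < M'"
      and q: "q = j * N + p" and h: "h \<in> H' j"
      and \<phi>: "\<phi> = top_map I p j h"
      using mem unfolding low_def by (auto split: if_splits)
    have "init_hom j h" using H' j h by (auto simp: admissible_def)
    then have "init_hom q (\<lambda>x. h (block_sum a N I x))"
      by (rule init_hom_compose) (use I q in \<open>auto intro: init_hom_block_sum\<close>)
    moreover have "init_hom q (\<lambda>x. block N k x j)" if "k \<in> I - {p}" for k
      unfolding block_def using that p q by (intro init_hom_coord) (auto simp: le_less)
    ultimately show ?thesis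
      unfolding \<phi> top_map_def by (intro init_hom_add init_hom_smult init_hom_sum) auto
  qed
  have "finite (low q)" for q
    using H' by (auto simp: low_def admissible_def intro!: finite_UN_I)
  then have adm: "admissible (Suc M) H"
    using low_hom init_hom_word_sum[OF _ E] finite_words[OF finE]
    by (auto simp: admissible_def H_def M_def intro!: init_hom_smult)
  have fin\<Sigma>: "finite \<Sigma>"
    using fin' finite_words[OF finE] by (simp add: \<Sigma>_def)
  have \<Sigma>: "init_hom (Suc M) (\<lambda>x. \<sigma> x i)" if mem: "\<sigma> \<in> \<Sigma>" and i: "i < Suc n" for \<sigma> i
  proof -
    obtain \<sigma>' I w where \<sigma>': "\<sigma>' \<in> \<Sigma>'" and I: "I \<subseteq> {..<N}" and w: "w \<in> words N E"
      and \<sigma>: "\<sigma> = (\<lambda>x i. if i < n then \<sigma>' (block_sum a N I x) i else A' *s x M + word_sum N w x)"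
      using mem unfolding \<Sigma>_def by auto
    have "init_hom (Suc M) (word_sum N w)"
      using init_hom_word_sum[OF w E] by (auto simp: init_hom_def M_def)
    moreover have "init_hom (Suc M) (\<lambda>x. \<sigma>' (block_sum a N I x) i)" if "i < n"
      using \<Sigma>'[OF \<sigma>' that]
      by (rule init_hom_compose) (use I in \<open>auto simp: M_def intro!: init_hom_block_sum[of _ _ _ M']\<close>)
    moreover have "init_hom (Suc M) (\<lambda>x :: nat \<Rightarrow> int ^ 'd. A' *s x M)"
      by (intro init_hom_smult init_hom_coord) simp
    ultimately show ?thesis
      unfolding \<sigma> by (cases "i < n") (simp_all add: init_hom_add)
  qed
  have rows_sub: "hom_rows M' H' A' (block_sum a N I x) \<subseteq> hom_rows (Suc M) H A x"
    if I: "I \<subseteq> {..<N}" "I \<noteq> {}" for I x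
  proof
    fix v assume "v \<in> hom_rows M' H' A' (block_sum a N I x)"
    then obtain j h where j: "j < M'" and h: "h \<in> H' j"
      and v: "v = A' *s block_sum a N I x j + h (block_sum a N I x)"
      by (auto simp: hom_rows_def hom_row_def)
    have finI: "finite I" using I finite_subset by blast
    define p where "p = Max I"
    have p: "p \<in> I" "\<forall>k\<in>I. k \<le> p" using finI I(2) by (auto simp: p_def)
    have pN: "p < N" using p I by blast
    have q: "j * N + p < M" using block_index_less[OF j pN] by (simp add: M_def)
    have "top_map I p j h \<in> low (j * N + p)"
      using I(1) p pN j h unfolding low_def by auto
    then have "top_map I p j h \<in> H (j * N + p)" using q by (simp add: H_def)
    moreover have "v = A *s x (j * N + p) + top_map I p j h x"
      unfolding v top_map_def using sum.remove[OF finI p(1), of "\<lambda>k. block N k x j"]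
      by (simp add: block_sum_def A_def vector_smult_assoc vector_add_ldistrib block_def mult.commute)
    ultimately show "v \<in> hom_rows (Suc M) H A x"
      using q unfolding hom_rows_def hom_row_def by force
  qed
  have "\<exists>\<sigma>\<in>\<Sigma>. \<forall>i<Suc n. hom_row a (G i) i (\<sigma> x) \<subseteq> hom_rows (Suc M) H A x \<and>
          (\<exists>k. \<forall>v\<in>hom_row a (G i) i (\<sigma> x). col v = k)"
    if col: "\<forall>v. col v < r" for x :: "nat \<Rightarrow> int ^ 'd" and col :: "int ^ 'd \<Rightarrow> nat"
  proof -
    \<comment> \<open>Each word is coloured like the element of the last row that it
      defines.\<close>
    have "mono_line N E (\<lambda>w. col (A *s x M + a *s word_sum N w x))"
      by (rule N) (simp add: col)
    then obtain l k0 where l: "l \<in> comb_lines N E"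
      and k0: "\<And>e. e \<in> E \<Longrightarrow> col (A *s x M + a *s word_sum N (subst_line l e) x) = k0"
      unfolding mono_line_def by blast
    define I where "I = {k. k < N \<and> l ! k = None}"
    define w where "w = subst_line l (\<lambda>x. 0)"
    have len: "length l = N" using l by (simp add: comb_lines_def)
    have w: "w \<in> words N E" unfolding w_def using subst_line_in_words[OF l zeroE] .
    have I: "I \<subseteq> {..<N}" "I \<noteq> {}"
      using l by (auto simp: I_def comb_lines_def in_set_conv_nth)
    \<comment> \<open>The line fixes \<open>I\<close>, and hence \<open>T\<close>, before
      \<open>\<sigma>'\<close> is chosen. This is harmless since all letters share the colour
      \<open>k0\<close>, whichever \<open>\<sigma>'\<close> arises.\<close>
    define T where "T = block_sum a N I x"
    obtain \<sigma>' where \<sigma>': "\<sigma>' \<in> \<Sigma>'"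
      and low_rows: "\<And>i. i < n \<Longrightarrow> hom_row a (G i) i (\<sigma>' T) \<subseteq> hom_rows M' H' A' T"
        "\<And>i. i < n \<Longrightarrow> \<exists>k. \<forall>v\<in>hom_row a (G i) i (\<sigma>' T). col v = k"
      using IH[OF col, of T] by blast
    define \<sigma> where
      "\<sigma> = (\<lambda>x i. if i < n then \<sigma>' (block_sum a N I x) i else A' *s x M + word_sum N w x)"
    have \<sigma>: "\<sigma> \<in> \<Sigma>" unfolding \<Sigma>_def \<sigma>_def using \<sigma>' I(1) w by force
    have \<sigma>_low: "\<phi> (\<sigma> x) = \<phi> (\<sigma>' T)" if "init_hom i \<phi>" "i \<le> n" for i \<phi>
      by (rule init_homD(2)[OF that(1)]) (use that(2) in \<open>simp add: \<sigma>_def T_def\<close>)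
    show ?thesis
    proof (intro bexI[OF _ \<sigma>] allI impI)
      fix i assume i: "i < Suc n"
      show "hom_row a (G i) i (\<sigma> x) \<subseteq> hom_rows (Suc M) H A x \<and>
          (\<exists>k. \<forall>v\<in>hom_row a (G i) i (\<sigma> x). col v = k)"
      proof (cases "i < n")
        case True
        have "hom_row a (G i) i (\<sigma> x) = hom_row a (G i) i (\<sigma>' T)"
          unfolding hom_row_def using True G(2)[OF i] \<sigma>_low[of i]
          by (intro image_cong) (auto simp: \<sigma>_def T_def)
        then show ?thesis
          using low_rows[OF True] rows_sub[OF I, of x] unfolding T_def by auto
      next
        case False
        then have [simp]: "i = n" using i by simp
        have "\<exists>e\<in>E. v = A *s x M + a *s word_sum N (subst_line l e) x"
          if "v \<in> hom_row a (G n) n (\<sigma> x)" for v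
        proof -
          obtain \<phi> where \<phi>: "\<phi> \<in> G n" and v: "v = a *s \<sigma> x n + \<phi> (\<sigma> x)"
            using \<open>v \<in> _\<close> by (auto simp: hom_row_def)
          \<comment> \<open>The given element of row \<open>n\<close> is the point of the line at
            this letter.\<close>
          define e where "e = (\<lambda>x. \<phi> (\<sigma>' x))"
          have e: "e \<in> E" using \<phi> \<sigma>' unfolding E_def e_def by force
          have "v = A *s x M + (a *s word_sum N w x + e T)"
            unfolding v using \<sigma>_low[OF G(2)[of n \<phi>]] \<phi>
            by (simp add: \<sigma>_def e_def A_def vector_add_ldistrib vector_smult_assoc)
          also have "a *s word_sum N w x + e T = a *s word_sum N (subst_line l e) x"
            using word_sum_subst_line[OF len E[OF e], of a x] unfolding T_def I_def w_def by simp
          finally show ?thesis using e by blast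
        qed
        moreover have "A *s x M + a *s word_sum N (subst_line l e) x \<in> hom_rows (Suc M) H A x"
          if "e \<in> E" for e
        proof -
          have "(\<lambda>x. a *s word_sum N (subst_line l e) x) \<in> H M"
            using subst_line_in_words[OF l that] unfolding H_def by auto
          then have "A *s x M + a *s word_sum N (subst_line l e) x \<in> hom_row A (H M) M x"
            unfolding hom_row_def by (rule rev_image_eqI) simp
          then show ?thesis unfolding hom_rows_def by blast
        qed
        ultimately have "v \<in> hom_rows (Suc M) H A x \<and> col v = k0"
          if "v \<in> hom_row a (G n) n (\<sigma> x)" for v
          using k0 that by metis
        then show ?thesis by auto
      qed
    qed
  qed
  then have col: "\<forall>x (col :: int ^ 'd \<Rightarrow> nat). (\<forall>v. col v < r) \<longrightarrow>
      (\<exists>\<sigma>\<in>\<Sigma>. \<forall>i<Suc n. hom_row a (G i) i (\<sigma> x) \<subseteq> hom_rows (Suc M) H A x \<and>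
         (\<exists>k. \<forall>v\<in>hom_row a (G i) i (\<sigma> x). col v = k))"
    by simp
  have A: "A \<noteq> 0" using a A' by (simp add: A_def)
  have "\<forall>\<sigma>\<in>\<Sigma>. \<forall>i<Suc n. init_hom (Suc M) (\<lambda>x. \<sigma> x i)"
    using \<Sigma> by blast
  then have "A \<noteq> 0 \<and> admissible (Suc M) H \<and> finite \<Sigma> \<and>
      (\<forall>\<sigma>\<in>\<Sigma>. \<forall>i<Suc n. init_hom (Suc M) (\<lambda>x. \<sigma> x i)) \<and>
      (\<forall>x (col :: int ^ 'd \<Rightarrow> nat). (\<forall>v. col v < r) \<longrightarrow>
         (\<exists>\<sigma>\<in>\<Sigma>. \<forall>i<Suc n. hom_row a (G i) i (\<sigma> x) \<subseteq> hom_rows (Suc M) H A x \<and>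
            (\<exists>k. \<forall>v\<in>hom_row a (G i) i (\<sigma> x). col v = k)))"
    by (intro conjI A adm fin\<Sigma> col)
  then show ?case by (intro exI)
qed

subsection \<open>Nonzero subsystems\<close>

definition perturb :: "(nat \<Rightarrow> nat) \<Rightarrow> (nat \<Rightarrow> int ^ 'd) \<Rightarrow> nat \<Rightarrow> int ^ 'd" where
  "perturb l x j = x (2 * j + 1) + int (l j) *s x (2 * j)"

text \<open>The multipliers are chosen in order. As \<open>A\<close> and \<open>x (2 * M)\<close>
  are nonzero, each map in row \<open>M\<close> excludes at most one of the
  \<open>card (H M) + 1\<close> candidates for \<open>l M\<close>.\<close>

lemma exists_perturb_nonzero:
  fixes H :: "nat \<Rightarrow> ((nat \<Rightarrow> int ^ 'd) \<Rightarrow> int ^ 'd) set"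
  assumes "admissible M H" and A: "A \<noteq> 0" and "\<And>k. k < 2 * M \<Longrightarrow> x k \<noteq> 0"
  shows "\<exists>l\<in>(\<Pi>\<^sub>E j\<in>{..<M}. {..card (H j)}). 0 \<notin> hom_rows M H A (perturb l x)"
  using assms(1,3)
proof (induction M)
  case 0
  then show ?case by (simp add: hom_rows_def)
next
  case (Suc M)
  then obtain l where l: "l \<in> (\<Pi>\<^sub>E j\<in>{..<M}. {..card (H j)})"
    and l0: "0 \<notin> hom_rows M H A (perturb l x)"
    by (auto simp: admissible_def)
  have H: "finite (H j)" "\<phi> \<in> H j \<Longrightarrow> init_hom j \<phi>" if "j \<le> M" for j \<phi>
    using Suc.prems(1) that by (auto simp: admissible_def)
  \<comment> \<open>A map in row \<open>j\<close> reads only entries below \<open>j\<close>, which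
    the multiplier at \<open>M\<close> does not affect.\<close>
  have stable: "\<phi> (perturb (l(M := v)) x) = \<phi> (perturb l x)"
    if "\<phi> \<in> H j" "j \<le> M" for \<phi> j v
    by (rule init_homD(2)[OF H(2)[OF that(2,1)]]) (use that in \<open>simp add: perturb_def\<close>)
  have "\<exists>v\<le>card (H M). 0 \<notin> hom_row A (H M) M (perturb (l(M := v)) x)"
  proof (rule ccontr)
    assume "\<not> ?thesis"
    then have "\<forall>v\<in>{..card (H M)}. \<exists>\<phi>\<in>H M.
        A *s (x (2 * M + 1) + int v *s x (2 * M)) + \<phi> (perturb l x) = 0"
      using stable[of _ M] by (force simp: hom_row_def perturb_def)
    \<comment> \<open>Here \<open>f v\<close> is a map that spoils the multiplier \<open>v\<close>;
      one map cannot spoil two.\<close>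
    then obtain f where f: "\<And>v. v \<le> card (H M) \<Longrightarrow> f v \<in> H M"
      "\<And>v. v \<le> card (H M) \<Longrightarrow>
        A *s (x (2 * M + 1) + int v *s x (2 * M)) + f v (perturb l x) = 0"
      by (metis atMost_iff)
    have "inj_on f {..card (H M)}"
    proof (rule inj_onI)
      fix v v' assume v: "v \<in> {..card (H M)}" "v' \<in> {..card (H M)}" "f v = f v'"
      then have "A *s (x (2 * M + 1) + int v *s x (2 * M)) =
          A *s (x (2 * M + 1) + int v' *s x (2 * M))"
        using f(2)[of v] f(2)[of v'] by (metis add_right_cancel atMost_iff)
      then have "(A * (int v - int v')) *s x (2 * M) = 0"
        by (simp add: vector_add_ldistrib vector_smult_assoc vector_sub_rdistrib right_diff_distrib
            del: vector_mul_eq_0)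
      then show "v = v'" using A Suc.prems(2)[of "2 * M"] by simp
    qed
    then have "card {..card (H M)} \<le> card (H M)"
      using f(1) H(1)[of M] by (intro card_inj_on_le[of f]) auto
    then show False by simp
  qed
  then obtain v where v: "v \<le> card (H M)" "0 \<notin> hom_row A (H M) M (perturb (l(M := v)) x)" by blast
  have "hom_row A (H j) j (perturb (l(M := v)) x) = hom_row A (H j) j (perturb l x)" if "j < M" for j
    unfolding hom_row_def using that stable[of _ j v] by (intro image_cong) (auto simp: perturb_def)
  then have "0 \<notin> hom_rows (Suc M) H A (perturb (l(M := v)) x)"
    using l0 v(2) by (auto simp: hom_rows_def less_Suc_eq)
  moreover have "l(M := v) \<in> (\<Pi>\<^sub>E j\<in>{..<Suc M}. {..card (H j)})"
    using l v(1) by (auto simp: PiE_iff extensional_def less_Suc_eq)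
  ultimately show ?case by blast
qed

text \<open>
  Combinations of nonzero entries of \<open>x\<close> can vanish. Bounded multiples of the even-indexed entries
  are therefore added to the odd-indexed ones, each unwanted zero excluding one multiple.
\<close>

lemma nonzero_subsystem:
  fixes H :: "nat \<Rightarrow> ((nat \<Rightarrow> int ^ 'd) \<Rightarrow> int ^ 'd) set"
  assumes H: "admissible M H" and A: "A \<noteq> 0"
  obtains H' where "admissible (2 * M) H'"
    and "\<And>x. (\<And>k. k < 2 * M \<Longrightarrow> x k \<noteq> 0) \<Longrightarrow>
      \<exists>y. hom_rows M H A y \<subseteq> hom_rows (2 * M) H' A x \<and> 0 \<notin> hom_rows M H A y"
proof
  define L where "L = (\<Pi>\<^sub>E j\<in>{..<M}. {..card (H j)})"
  \<comment> \<open>The leading term is \<open>A *s x (2 * j + 1)\<close>; the multiple of the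
    earlier entry \<open>x (2 * j)\<close> is absorbed into the map. Since the right
    \<open>l\<close> depends on \<open>x\<close>, all of the finite set \<open>L\<close> is included
    below.\<close>
  define shifted where "shifted l j h = (\<lambda>x. (A * int (l j)) *s x (2 * j) + h (perturb l x))"
    for l j and h :: "(nat \<Rightarrow> int ^ 'd) \<Rightarrow> int ^ 'd"
  define H' where "H' q = (\<Union>l\<in>L. \<Union>j\<in>{..<M}. if q = 2 * j + 1 then shifted l j ` H j else {})" for q
  have "finite L" unfolding L_def by (intro finite_PiE) auto
  then have "finite (H' q)" for q
    using H by (auto simp: H'_def admissible_def)
  moreover have "init_hom (2 * j + 1) (shifted l j h)" if "j < M" "h \<in> H j" for l j h
  proof -
    have "init_hom j h" using H that by (simp add: admissible_def)
    then have "init_hom (2 * j + 1) (\<lambda>x. h (perturb l x))"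
    proof (rule init_hom_compose)
      show "init_hom (2 * j + 1) (\<lambda>x. perturb l x k)" if "k < j" for k
        unfolding perturb_def
        using that by (intro init_hom_add init_hom_smult init_hom_coord) auto
    qed
    then show ?thesis
      unfolding shifted_def by (intro init_hom_add init_hom_smult init_hom_coord) auto
  qed
  ultimately show "admissible (2 * M) H'"
    by (auto simp: admissible_def H'_def split: if_splits)
  fix x :: "nat \<Rightarrow> int ^ 'd"
  assume "\<And>k. k < 2 * M \<Longrightarrow> x k \<noteq> 0"
  then obtain l where l: "l \<in> L" and nz: "0 \<notin> hom_rows M H A (perturb l x)"
    using exists_perturb_nonzero[OF H A] unfolding L_def by blast
  have "hom_rows M H A (perturb l x) \<subseteq> hom_rows (2 * M) H' A x"
  proof
    fix v assume "v \<in> hom_rows M H A (perturb l x)"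
    then obtain j h where j: "j < M" and h: "h \<in> H j"
      and v: "v = A *s perturb l x j + h (perturb l x)"
      by (auto simp: hom_rows_def hom_row_def)
    have "shifted l j h \<in> H' (2 * j + 1)"
      using l j h by (auto simp: H'_def)
    moreover have "v = A *s x (2 * j + 1) + shifted l j h x"
      unfolding v shifted_def by (simp add: perturb_def vector_add_ldistrib vector_smult_assoc)
    moreover have "2 * j + 1 < 2 * M" using j by simp
    ultimately show "v \<in> hom_rows (2 * M) H' A x"
      unfolding hom_rows_def hom_row_def by blast
  qed
  then show "\<exists>y. hom_rows M H A y \<subseteq> hom_rows (2 * M) H' A x \<and> 0 \<notin> hom_rows M H A y"
    using nz by blast
qed

subsection \<open>From rows to D-sets\<close>

text \<open>
  The zero map makes \<open>a *s s i\<close> itself an element of its row, hence nonzero in a subsystem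
  without \<open>0\<close>, and accounts for the entry \<open>c (s ! 0)\<close> of the D-set.
\<close>

definition select ::
    "nat \<Rightarrow> (nat \<Rightarrow> ((int ^ 'd) list \<Rightarrow> int ^ 'd) set) \<Rightarrow> nat \<Rightarrow>
     ((nat \<Rightarrow> int ^ 'd) \<Rightarrow> int ^ 'd) set" where
  "select m F i = insert (\<lambda>x. 0)
     (\<Union>j\<in>{1..m}. \<Union>L\<in>{L. set L \<subseteq> {..<i} \<and> length L = j}. (\<lambda>f x. f (map x L)) ` F j)"

lemma init_hom_tuple_hom:
  fixes f :: "(int ^ 'd) list \<Rightarrow> int ^ 'd"
  assumes "tuple_hom (length L) f" and "set L \<subseteq> {..<i}"
  shows "init_hom i (\<lambda>x. f (map x L))"
  unfolding init_hom_def
proof (intro conjI allI impI)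
  fix x y :: "nat \<Rightarrow> int ^ 'd"
  have "map (\<lambda>k. x k + y k) L = map2 (+) (map x L) (map y L)"
    by (simp add: zip_map_map zip_same_conv_map)
  then show "f (map (\<lambda>k. x k + y k) L) = f (map x L) + f (map y L)"
    using assms(1) by (simp add: tuple_hom_def)
next
  fix x y :: "nat \<Rightarrow> int ^ 'd"
  assume "\<forall>k<i. x k = y k"
  then have "map x L = map y L" using assms(2) by auto
  then show "f (map x L) = f (map y L)" by (rule arg_cong)
qed

lemma admissible_select: "hom_families m F \<Longrightarrow> admissible n (select m F)"
  by (auto simp: admissible_def select_def hom_families_def finite_lists_length_eq
      intro!: init_hom_0 init_hom_tuple_hom)

text \<open>Padding with zeros is additive, so the passage back to lists preserves
  homomorphisms.\<close>

lemma tuple_hom_init_hom: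
  assumes "init_hom i \<phi>"
  shows "tuple_hom i (\<lambda>xs. \<phi> (\<lambda>k. if k < i then xs ! k else 0))"
  unfolding tuple_hom_def
proof (intro allI impI)
  fix xs ys :: "(int ^ 'a) list"
  assume "length xs = i \<and> length ys = i"
  then have "(\<lambda>k. if k < i then map2 (+) xs ys ! k else 0) =
      (\<lambda>k. (if k < i then xs ! k else 0) + (if k < i then ys ! k else 0))"
    by auto
  then show "\<phi> (\<lambda>k. if k < i then map2 (+) xs ys ! k else 0) =
      \<phi> (\<lambda>k. if k < i then xs ! k else 0) + \<phi> (\<lambda>k. if k < i then ys ! k else 0)"
    using init_homD(1)[OF assms] by simp
qed

text \<open>Among \<open>r * m + 1\<close> rows some colour occurs more than \<open>m\<close> times.
  The order matters because each chosen row may use only earlier entries.\<close>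

lemma pigeonhole_strict_list:
  assumes "f ` {..<r * m + 1} \<subseteq> {..<r::nat}"
  obtains L k where "sorted_wrt (<) L" "length L = m + 1" "set L \<subseteq> {..<r * m + 1}"
    "\<And>i. i \<in> set L \<Longrightarrow> f i = k"
proof -
  have "\<exists>k<r. m < card {i \<in> {..<r * m + 1}. f i = k}"
  proof (rule ccontr)
    assume "\<not> ?thesis"
    then have "\<And>k. k < r \<Longrightarrow> card {i \<in> {..<r * m + 1}. f i = k} \<le> m" by (meson not_less)
    moreover have "(\<Union>k<r. {i \<in> {..<r * m + 1}. f i = k}) = {..<r * m + 1}"
      using assms by blast
    then have "r * m + 1 \<le> (\<Sum>k<r. card {i \<in> {..<r * m + 1}. f i = k})"
      using card_UN_le[of "{..<r}" "\<lambda>k. {i \<in> {..<r * m + 1}. f i = k}"] by simp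
    ultimately show False
      using sum_bounded_above[of "{..<r}" "\<lambda>k. card {i \<in> {..<r * m + 1}. f i = k}" m] by simp
  qed
  then obtain k where "m < card {i \<in> {..<r * m + 1}. f i = k}"
    by blast
  then have "m + 1 \<le> card {i \<in> {..<r * m + 1}. f i = k}" by simp
  then obtain J where J: "J \<subseteq> {i \<in> {..<r * m + 1}. f i = k}" "card J = m + 1" "finite J"
    by (rule obtain_subset_with_card_n)
  show ?thesis
    using J by (intro that[of "sorted_list_of_set J" k]) auto
qed

text \<open>As \<open>L\<close> increases, the indices in \<open>take j L\<close> lie below
  \<open>L ! j\<close>, so \<open>select\<close> has provided the map needed in that row.\<close>

lemma D_set_select_subset:
  assumes c: "c = (\<lambda>x. a *s x)" and L: "sorted_wrt (<) L" "length L = m + 1"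
  shows "D_set m F c (map s L) \<subseteq> (\<Union>i\<in>set L. hom_row a (select m F i) i s)"
proof
  fix v assume "v \<in> D_set m F c (map s L)"
  then consider "v = c (s (L ! 0))"
    | j f where "j \<in> {1..m}" "f \<in> F j" "v = f (take j (map s L)) + c (s (L ! j))"
    using L(2) by (auto simp: D_set_def)
  then show "v \<in> (\<Union>i\<in>set L. hom_row a (select m F i) i s)"
  proof cases
    case 1
    then have "v \<in> hom_row a (select m F (L ! 0)) (L ! 0) s"
      by (auto simp: hom_row_def select_def c)
    then show ?thesis using L(2) by force
  next
    case 2
    have "set (take j L) \<subseteq> {..<L ! j}"
      using L 2(1) sorted_wrt_nth_less[OF L(1)] by (force simp: in_set_conv_nth)
    moreover have "length (take j L) = j" using 2(1) L(2) by simp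
    ultimately have "(\<lambda>x. f (map x (take j L))) \<in> select m F (L ! j)"
      using 2(1,2) unfolding select_def by blast
    then have "v \<in> hom_row a (select m F (L ! j)) (L ! j) s"
      using 2(3) by (force simp: hom_row_def c take_map add.commute)
    then show ?thesis using 2(1) L(2) by force
  qed
qed

section \<open>The finite colouring theorem and the partition theorem\<close>

theorem deuber_colouring:
  fixes F :: "nat \<Rightarrow> ((int ^ 'd) list \<Rightarrow> int ^ 'd) set"
  assumes "scalar_hom c" and F: "hom_families m F" and r: "r \<ge> 1"
  shows "\<exists>M C H. M \<ge> 1 \<and> scalar_hom C \<and> hom_families M H \<and>
    (\<forall>S\<in>nonzero_tuples (M + 1). \<forall>col :: int ^ 'd \<Rightarrow> nat.
       col ` D_set M H C S \<subseteq> {1..r} \<longrightarrow>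
       (\<exists>s\<in>nonzero_tuples (m + 1). D_set m F c s \<subseteq> D_set M H C S \<and>
          (\<exists>k\<in>{1..r}. \<forall>x\<in>D_set m F c s. col x = k)))"
proof -
  obtain a where a: "a \<noteq> 0" and c: "c = (\<lambda>x. a *s x)"
    using assms(1) by (auto simp: scalar_hom_def)
  define n where "n = r * m + 1"
  obtain M H A \<Sigma> where A: "A \<noteq> 0" and H: "admissible M H"
    and mono: "\<And>x (col :: int ^ 'd \<Rightarrow> nat). (\<forall>v. col v < r) \<Longrightarrow>
       \<exists>\<sigma>\<in>\<Sigma>. \<forall>i<n. hom_row a (select m F i) i (\<sigma> x) \<subseteq> hom_rows M H A x \<and>
          (\<exists>k. \<forall>v\<in>hom_row a (select m F i) i (\<sigma> x). col v = k)"
    using monochromatic_rows[OF admissible_select[OF F, of n] a, of r] by blast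
  obtain H' where H': "admissible (2 * M) H'"
    and nonzero: "\<And>x. (\<And>k. k < 2 * M \<Longrightarrow> x k \<noteq> 0) \<Longrightarrow>
      \<exists>y. hom_rows M H A y \<subseteq> hom_rows (2 * M) H' A x \<and> 0 \<notin> hom_rows M H A y"
    using nonzero_subsystem[OF H A] by blast
  define C :: "int ^ 'd \<Rightarrow> int ^ 'd" where "C x = A *s x" for x
  define K where "K i = (if i < 2 * M
      then (\<lambda>\<phi> xs. \<phi> (\<lambda>k. if k < i then xs ! k else 0)) ` H' i else {})" for i
  \<comment> \<open>The families from index \<open>2 * M\<close> on are empty; the extra one ensures
    \<open>M' >= 1\<close> even if \<open>M = 0\<close>.\<close>
  define M' where "M' = 2 * M + 1"
  have "hom_families M' K"
    using H' by (auto simp: hom_families_def K_def admissible_def intro: tuple_hom_init_hom)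
  moreover have "scalar_hom C" using A by (auto simp: scalar_hom_def C_def)
  moreover have "\<exists>s\<in>nonzero_tuples (m + 1). D_set m F c s \<subseteq> D_set M' K C S \<and>
          (\<exists>k\<in>{1..r}. \<forall>x\<in>D_set m F c s. col x = k)"
    if S: "S \<in> nonzero_tuples (M' + 1)" and col: "col ` D_set M' K C S \<subseteq> {1..r}"
    for S and col :: "int ^ 'd \<Rightarrow> nat"
  proof -
    have len: "length S = 2 * M + 2" using S by (simp add: nonzero_tuples_def M'_def)
    have rows_D: "hom_rows (2 * M) H' A (\<lambda>k. S ! k) \<subseteq> D_set M' K C S"
    proof
      fix v assume "v \<in> hom_rows (2 * M) H' A (\<lambda>k. S ! k)"
      then obtain i \<phi> where i: "i < 2 * M" and \<phi>: "\<phi> \<in> H' i" and v: "v = A *s S ! i + \<phi> ((!) S)"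
        by (auto simp: hom_rows_def hom_row_def)
      have hom: "init_hom i \<phi>" using H' i \<phi> by (simp add: admissible_def)
      show "v \<in> D_set M' K C S"
      \<comment> \<open>The families of a D-set start at index 1. The maps of row 0 vanish, which
        leaves the entry \<open>C (S ! 0)\<close>.\<close>
      proof (cases "i = 0")
        case True
        then have "\<phi> ((!) S) = \<phi> (\<lambda>k. 0)" using hom by (intro init_homD(2)[OF hom]) auto
        then have "v = C (S ! 0)"
          using True v init_hom_zero[OF hom] by (simp add: C_def)
        then show ?thesis by (simp add: D_set_def)
      next
        case False
        have "\<phi> ((!) S) = \<phi> (\<lambda>k. if k < i then take i S ! k else 0)"
          by (rule init_homD(2)[OF hom]) simp
        moreover have "(\<lambda>xs. \<phi> (\<lambda>k. if k < i then xs ! k else 0)) \<in> K i"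
          using i \<phi> by (simp add: K_def)
        ultimately show ?thesis
          using False i v unfolding D_set_def C_def M'_def by (force simp: add.commute)
      qed
    qed
    have "S ! k \<noteq> 0" if "k < 2 * M" for k
      using S that len by (simp add: nonzero_tuples_def)
    \<comment> \<open>Zero is removed from the whole large system first, hence from every subsystem
      found later.\<close>
    then obtain y where y: "hom_rows M H A y \<subseteq> hom_rows (2 * M) H' A (\<lambda>k. S ! k)" "0 \<notin> hom_rows M H A y"
      using nonzero[of "\<lambda>k. S ! k"] by blast
    \<comment> \<open>Colours are shifted to start at 0, and the default 0 makes the colouring
      total, as \<open>mono\<close> requires. On the D-set of \<open>S\<close> this loses
      nothing.\<close>
    define col' where "col' v = (if col v \<in> {1..r} then col v - 1 else 0)" for v
    have "\<forall>v. col' v < r" using r by (auto simp: col'_def)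
    then obtain \<sigma> where \<sigma>: "\<And>i. i < n \<Longrightarrow> hom_row a (select m F i) i (\<sigma> y) \<subseteq> hom_rows M H A y"
      "\<And>i. i < n \<Longrightarrow> \<exists>k. \<forall>v\<in>hom_row a (select m F i) i (\<sigma> y). col' v = k"
      using mono[of col' y] by blast
    define s where "s = \<sigma> y"
    have head: "a *s s i \<in> hom_row a (select m F i) i s" for i
      by (force simp: hom_row_def select_def)
    have s0: "s i \<noteq> 0" if "i < n" for i
      using head[of i] \<sigma>(1)[OF that] y(2) unfolding s_def by auto
    have colour: "col' v = col' (a *s s i)" if "i < n" "v \<in> hom_row a (select m F i) i s" for i v
      using \<sigma>(2)[OF that(1)] that(2) head[of i] unfolding s_def by metis
    have "(\<lambda>i. col' (a *s s i)) ` {..<r * m + 1} \<subseteq> {..<r}"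
      using \<open>\<forall>v. col' v < r\<close> by blast
    then obtain L k where L: "sorted_wrt (<) L" "length L = m + 1" "set L \<subseteq> {..<n}"
      and k: "\<And>i. i \<in> set L \<Longrightarrow> col' (a *s s i) = k"
      unfolding n_def by (rule pigeonhole_strict_list) (rule that[unfolded n_def])
    have D: "D_set m F c (map s L) \<subseteq> (\<Union>i\<in>set L. hom_row a (select m F i) i s)"
      using D_set_select_subset[OF c L(1,2)] .
    have sub: "D_set m F c (map s L) \<subseteq> D_set M' K C S"
      using D L(3) \<sigma>(1) y(1) rows_D unfolding s_def by blast
    have "col x = k + 1" if "x \<in> D_set m F c (map s L)" for x
    proof -
      have "col' x = k" using D that L(3) colour k by fastforce
      moreover have "col x \<in> {1..r}" using sub col that by blast
      ultimately show ?thesis by (auto simp: col'_def)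
    qed
    moreover have "k + 1 \<in> {1..r}"
    proof -
      have "L ! 0 \<in> set L" using L(2) by simp
      then show ?thesis using k \<open>\<forall>v. col' v < r\<close> by (metis Suc_eq_plus1 Suc_leI atLeastAtMost_iff le_add2)
    qed
    moreover have "map s L \<in> nonzero_tuples (m + 1)"
      using L(2,3) s0 by (auto simp: nonzero_tuples_def)
    ultimately show ?thesis using sub by blast
  qed
  moreover have "M' \<ge> 1" by (simp add: M'_def)
  ultimately show ?thesis by blast
qed

theorem theorem1p7:
  fixes m :: nat
    and c :: "int ^ 'd \<Rightarrow> int ^ 'd"
    and F :: "nat \<Rightarrow> ((int ^ 'd) list \<Rightarrow> int ^ 'd) set"
  assumes "m \<ge> 1"
    and "scalar_hom c"
    and "hom_families m F"
  shows
    "(\<forall>(r::nat) (C :: nat \<Rightarrow> (int ^ 'd) set).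
        (\<Union>i\<in>{1..r}. C i) = UNIV \<and> disjoint_family_on C {1..r} \<longrightarrow>
        (\<exists>i\<in>{1..r}. \<exists>s\<in>nonzero_tuples (m + 1). D_set m F c s \<subseteq> C i))
     \<and>
     (\<forall>r::nat. r \<ge> 1 \<longrightarrow>
        (\<exists>(M::nat) (C :: int ^ 'd \<Rightarrow> int ^ 'd) (H :: nat \<Rightarrow> ((int ^ 'd) list \<Rightarrow> int ^ 'd) set).
           M \<ge> 1 \<and> scalar_hom C \<and> hom_families M H \<and>
           (\<forall>S\<in>nonzero_tuples (M + 1). \<forall>col :: int ^ 'd \<Rightarrow> nat.
              col ` D_set M H C S \<subseteq> {1..r} \<longrightarrow>
              (\<exists>s\<in>nonzero_tuples (m + 1).
                 D_set m F c s \<subseteq> D_set M H C S \<and>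
                 (\<exists>k\<in>{1..r}. \<forall>x\<in>D_set m F c s. col x = k)))))"
proof (intro conjI allI impI)
  fix r :: nat and C :: "nat \<Rightarrow> (int ^ 'd) set"
  assume C: "(\<Union>i\<in>{1..r}. C i) = UNIV \<and> disjoint_family_on C {1..r}"
  then have "\<forall>v. \<exists>i. i \<in> {1..r} \<and> v \<in> C i" by blast
  \<comment> \<open>Choosing a class for each vector gives a colouring; the colour of 0 then shows
    \<open>r >= 1\<close>.\<close>
  then obtain col where col: "\<And>v. col v \<in> {1..r}" "\<And>v. v \<in> C (col v)" by metis
  have r: "r \<ge> 1" using col(1)[of 0] by simp
  obtain M K H where main: "\<forall>S\<in>nonzero_tuples (M + 1). \<forall>col :: int ^ 'd \<Rightarrow> nat.
      col ` D_set M H K S \<subseteq> {1..r} \<longrightarrow>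
      (\<exists>s\<in>nonzero_tuples (m + 1). D_set m F c s \<subseteq> D_set M H K S \<and>
         (\<exists>k\<in>{1..r}. \<forall>x\<in>D_set m F c s. col x = k))"
    using deuber_colouring[OF assms(2,3) r] by (elim exE conjE) (rule that)
  have "1 \<noteq> (0 :: int ^ 'd)" by (simp add: vec_eq_iff)
  \<comment> \<open>Any nonzero tuple serves as \<open>S\<close>, since now all vectors are
    coloured.\<close>
  then have "replicate (M + 1) (1 :: int ^ 'd) \<in> nonzero_tuples (M + 1)"
    by (simp add: nonzero_tuples_def)
  then obtain s k where "s \<in> nonzero_tuples (m + 1)" "k \<in> {1..r}" "\<forall>x\<in>D_set m F c s. col x = k"
    using col(1) main[rule_format, of _ col] by (metis image_subsetI)
  then show "\<exists>i\<in>{1..r}. \<exists>s\<in>nonzero_tuples (m + 1). D_set m F c s \<subseteq> C i"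
    using col(2) by (metis subsetI)
qed (rule deuber_colouring[OF assms(2,3)])

end
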